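(* Let $r_{det}>0$ and let $f\in C^\infty(\mathbb{R}^3)$ be compactly supported in $B(0,r_{det})$ with $f(\vec x)=f(-\vec x)$ for all $\vec x\in\mathbb{R}^3$. Then $$\mathcal{R}_Pf(\hat\theta,t)=F(R_Sf)(\hat\theta,t)\qquad\text{for all }(\hat\theta,t)\in S^2\times[0,\infty).$$
   Context: $B(0,r_{det})$ is the open ball in $\mathbb{R}^3$ of radius $r_{det}$ centered at the origin; $S^2$ is the unit sphere in $\mathbb{R}^3$; $dS$ denotes the standard (unnormalized) measure on the unit sphere $S^2$ or on a unit circle, according to the domain of integration. The transforms are defined for $(\hat\theta,t),(\hat\alpha,t)\in S^2\times[0,\infty)$ by: - Radon-type transform: $\displaystyle \mathcal{R}_Pf(\hat\theta,t)=\int_{\hat\alpha\in S^2,\ \hat\theta\cdot\hat\alpha=0}\int_{S^2} f(r_{det}\hat\alpha+t\hat\beta)\,dS(\hat\beta)\,dS(\hat\alpha)$. - Spherical Radon transform of a locally integrable function $f$ on $\mathbb{R}^3$: $\displaystyle R_Sf(\hat\alpha,t)=\int_{S^2}f(r_{det}\hat\alpha+t\hat\beta)\,dS(\hat\beta)$. - Minkowski-Funk transform of a locally integrable function $\phi$ on $S^2\times[0,\infty)$ with $\phi(\hat\alpha,t)=\phi(-\hat\alpha,t)$: $\displaystyle F\phi(\hat\theta,t)=\int_{\hat\alpha\in S^2,\ \hat\theta\cdot\hat\alpha=0}\phi(\hat\alpha,t)\,dS(\hat\alpha)$. *)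

theory Defs
  imports "HOL-Analysis.Analysis"
begin

section \<open>Smooth functions with compact support\<close>

primrec k_times_differentiable ::
  "nat \<Rightarrow> ('a::real_normed_vector \<Rightarrow> 'b::real_normed_vector) \<Rightarrow> bool" where
  "k_times_differentiable 0 f \<longleftrightarrow> continuous_on UNIV f"
| "k_times_differentiable (Suc k) f \<longleftrightarrow>
     (\<forall>x. f differentiable (at x)) \<and>
     (\<forall>v. k_times_differentiable k (\<lambda>x. frechet_derivative f (at x) v))"

text \<open>
  On a finite-dimensional domain, continuity of all iterated directional derivatives is
  the usual notion of a function of class \<open>C\<^sup>\<infinity>\<close>.
\<close>

definition smooth :: "('a::euclidean_space \<Rightarrow> 'b::real_normed_vector) \<Rightarrow> bool" where
  "smooth f \<longleftrightarrow> (\<forall>k. k_times_differentiable k f)"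

definition compactly_supported_in :: "('a::euclidean_space \<Rightarrow> 'b::zero) \<Rightarrow> 'a set \<Rightarrow> bool" where
  "compactly_supported_in f U \<longleftrightarrow>
     compact (closure {x. f x \<noteq> 0}) \<and> closure {x. f x \<noteq> 0} \<subseteq> U"


section \<open>Surface measure on the unit sphere\<close>

text \<open>
  The unnormalized surface measure of \<open>A\<close> is the dimension times the Lebesgue measure of
  the cone \<open>{r *\<^sub>R a | r a. 0 < r \<and> r \<le> 1 \<and> a \<in> A}\<close>; this cone is the preimage of \<open>A\<close>
  under \<open>x \<mapsto> x / norm x\<close> in the punctured unit ball.
\<close>

definition sphere_measure :: "'a::euclidean_space measure" where
  "sphere_measure =
     scale_measure (of_nat DIM('a))
       (distr (restrict_space lborel (cball 0 1 - {0})) (restrict_space borel (sphere 0 1))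
          (\<lambda>x. x /\<^sub>R norm x))"

lemma space_sphere_measure [simp]: "space (sphere_measure :: 'a::euclidean_space measure) = sphere 0 1"
  by (simp add: sphere_measure_def space_scale_measure space_restrict_space)

lemma sets_sphere_measure [simp, measurable_cong]:
  "sets (sphere_measure :: 'a::euclidean_space measure) = sets (restrict_space borel (sphere 0 1))"
  by (simp add: sphere_measure_def)

lemma emeasure_sphere_measure:
  fixes A :: "'a::euclidean_space set"
  assumes "A \<in> sets borel" "A \<subseteq> sphere 0 1"
  shows "emeasure sphere_measure A =
           of_nat DIM('a) * emeasure lborel {r *\<^sub>R a | r a. 0 < r \<and> r \<le> 1 \<and> a \<in> A}"
proof -
  let ?M = "restrict_space lborel (cball 0 1 - {0}) :: 'a measure"
  let ?N = "restrict_space borel (sphere 0 1) :: 'a measure"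
  have "(\<lambda>x::'a. x /\<^sub>R norm x) \<in> borel_measurable borel"
    by measurable
  then have meas: "(\<lambda>x. x /\<^sub>R norm x) \<in> measurable ?M ?N"
    by (intro measurable_restrict_space2 measurable_restrict_space1)
       (auto simp: space_restrict_space)
  have A: "A \<in> sets ?N"
    using assms by (auto simp: sets_restrict_space)
  have "(\<lambda>x. x /\<^sub>R norm x) -` A \<inter> space ?M = {r *\<^sub>R a | r a. 0 < r \<and> r \<le> 1 \<and> a \<in> A}"
    (is "?L = ?R")
  proof (intro set_eqI iffI)
    fix x assume "x \<in> ?L"
    then show "x \<in> ?R"
      by (intro CollectI exI[of _ "norm x"] exI[of _ "x /\<^sub>R norm x"]) (auto simp: space_restrict_space)
  next
    fix x assume "x \<in> ?R"
    then obtain r a where x: "x = r *\<^sub>R a" "0 < r" "r \<le> 1" "a \<in> A" by blast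
    moreover have "norm a = 1" using x assms by auto
    ultimately show "x \<in> ?L" by (auto simp: space_restrict_space)
  qed
  moreover have "?L \<subseteq> cball 0 1 - {0}"
    by (auto simp: space_restrict_space)
  ultimately show ?thesis
    by (simp add: sphere_measure_def emeasure_distr[OF meas A] emeasure_restrict_space)
qed

lemma emeasure_sphere_measure_sphere: "emeasure sphere_measure (sphere (0 :: real^3) 1) = 4 * pi"
proof -
  have "{r *\<^sub>R a | r a. 0 < r \<and> r \<le> 1 \<and> a \<in> sphere (0 :: real^3) 1} = cball 0 1 - {0}"
    (is "?L = ?R")
  proof (intro set_eqI iffI)
    fix x assume "x \<in> ?R"
    then show "x \<in> ?L"
      by (intro CollectI exI[of _ "norm x"] exI[of _ "x /\<^sub>R norm x"]) auto
  qed auto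
  moreover have "emeasure lborel (cball 0 1 - {0 :: real^3}) = emeasure lborel (cball (0 :: real^3) 1)"
    by (subst emeasure_Diff) auto
  ultimately have "emeasure sphere_measure (sphere (0 :: real^3) 1) = 3 * ennreal (unit_ball_vol 3)"
    by (subst emeasure_sphere_measure) (auto simp: emeasure_cball)
  also have "\<dots> = ennreal (3 * unit_ball_vol 3)"
    by (simp add: ennreal_mult)
  also have "3 * unit_ball_vol 3 = 4 * pi"
    by (simp add: eval_unit_ball_vol fact_numeral power3_eq_cube)
  finally show ?thesis .
qed


section \<open>Arc length measure on great circles\<close>

definition great_circle :: "real^3 \<Rightarrow> (real^3) set" where
  "great_circle \<theta> = {\<alpha> \<in> sphere 0 1. \<theta> \<bullet> \<alpha> = 0}"

definition orthonormal_frame :: "real^3 \<Rightarrow> real^3 \<Rightarrow> real^3 \<Rightarrow> bool" where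
  "orthonormal_frame \<theta> u v \<longleftrightarrow>
     u \<in> great_circle \<theta> \<and> v \<in> great_circle \<theta> \<and> u \<bullet> v = 0"

definition circle_param :: "real^3 \<Rightarrow> real^3 \<Rightarrow> real \<Rightarrow> real^3" where
  "circle_param u v s = cos s *\<^sub>R u + sin s *\<^sub>R v"

text \<open>
  Arc length is transported from \<open>{0..<2 * pi}\<close> along the unit-speed parametrization given by
  some orthonormal basis \<open>(u, v)\<close> of the plane orthogonal to \<open>\<theta>\<close>. The choice of the basis is
  immaterial, see lemma \<open>great_circle_measure_eq\<close> below.
\<close>

definition great_circle_measure :: "real^3 \<Rightarrow> (real^3) measure" where
  "great_circle_measure \<theta> =
     (let (u, v) = (SOME (u, v). orthonormal_frame \<theta> u v)
      in distr (restrict_space lborel {0..<2 * pi}) (restrict_space borel (great_circle \<theta>))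
           (circle_param u v))"

lemma orthonormal_frame_exists:
  assumes "\<theta> \<in> sphere 0 1"
  shows "\<exists>u v. orthonormal_frame \<theta> u v"
proof -
  obtain w where w: "w \<noteq> 0" "orthogonal \<theta> w"
    using orthogonal_to_vector_exists[of \<theta>] by (auto simp: orthogonal_commute)
  define u where "u = w /\<^sub>R norm w"
  have u: "norm u = 1" "\<theta> \<bullet> u = 0"
    using w by (auto simp: u_def orthogonal_def)
  have "(norm (cross3 \<theta> u))\<^sup>2 = 1"
    using norm_cross[of \<theta> u] u assms by simp
  then have "norm (cross3 \<theta> u) = 1"
    by (simp add: power2_eq_1_iff) (smt (verit) norm_ge_zero)
  moreover have "u \<bullet> cross3 \<theta> u = 0" "\<theta> \<bullet> cross3 \<theta> u = 0"
    by (auto simp: dot_cross_self)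
  ultimately show ?thesis
    using u by (intro exI[of _ u] exI[of _ "cross3 \<theta> u"])
      (auto simp: orthonormal_frame_def great_circle_def)
qed

lemma circle_param_in_great_circle:
  assumes "orthonormal_frame \<theta> u v"
  shows "circle_param u v s \<in> great_circle \<theta>"
proof -
  have *: "norm u = 1" "norm v = 1" "u \<bullet> v = 0" "v \<bullet> u = 0" "\<theta> \<bullet> u = 0" "\<theta> \<bullet> v = 0"
    using assms by (auto simp: orthonormal_frame_def great_circle_def inner_commute)
  then have "u \<bullet> u = 1" "v \<bullet> v = 1"
    by (auto simp: dot_square_norm)
  with * have "circle_param u v s \<bullet> circle_param u v s = 1"
    by (simp add: circle_param_def algebra_simps flip: power2_eq_square)
  then show ?thesis
    using * by (simp add: great_circle_def circle_param_def norm_eq_1 inner_add_right)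
qed

lemma measurable_circle_param:
  assumes "orthonormal_frame \<theta> u v"
  shows "circle_param u v \<in> measurable borel (restrict_space borel (great_circle \<theta>))"
proof (rule measurable_restrict_space2)
  show "circle_param u v \<in> space borel \<rightarrow> great_circle \<theta>"
    using circle_param_in_great_circle[OF assms] by auto
  show "circle_param u v \<in> borel_measurable borel"
    unfolding circle_param_def [abs_def]
    by (intro borel_measurable_continuous_onI continuous_intros)
qed

lemma great_circle_expansion:
  assumes "\<theta> \<in> sphere 0 1" "orthonormal_frame \<theta> u v" "\<theta> \<bullet> w = 0"
  shows "w = (w \<bullet> u) *\<^sub>R u + (w \<bullet> v) *\<^sub>R v"
proof -
  have *: "norm u = 1" "norm v = 1" "u \<bullet> v = 0" "\<theta> \<bullet> u = 0" "\<theta> \<bullet> v = 0" "norm \<theta> = 1"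
    using assms by (auto simp: orthonormal_frame_def great_circle_def)
  then have **: "u \<bullet> u = 1" "v \<bullet> v = 1" "\<theta> \<bullet> \<theta> = 1"
    by (auto simp: dot_square_norm)
  define z where "z = w - (w \<bullet> u) *\<^sub>R u - (w \<bullet> v) *\<^sub>R v"
  have z: "z \<bullet> u = 0" "z \<bullet> v = 0" "z \<bullet> \<theta> = 0"
    using * ** assms(3) by (auto simp: z_def algebra_simps inner_commute)
  have ne: "u \<noteq> v" "u \<noteq> \<theta>" "v \<noteq> \<theta>" using * ** by auto
  have "pairwise orthogonal {\<theta>, u, v}"
    using * by (auto simp: pairwise_def orthogonal_def inner_commute)
  then have ind: "independent {\<theta>, u, v}"
    by (rule pairwise_orthogonal_independent) (use * in auto)
  have "card {\<theta>, u, v} = 3" using ne by auto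
  then have "span {\<theta>, u, v} = UNIV"
    using card_ge_dim_independent[of "{\<theta>, u, v}" UNIV] ind by auto
  moreover have "orthogonal z y" if "y \<in> span {\<theta>, u, v}" for y
    using that by (rule orthogonal_to_span) (use z in \<open>auto simp: orthogonal_def\<close>)
  ultimately have "orthogonal z z" by auto
  then have "z = 0" by (simp add: orthogonal_def)
  then show ?thesis by (simp add: z_def diff_eq_eq add.commute)
qed

lemma emeasure_lborel_periodic:
  fixes T :: "real set"
  assumes T: "T \<in> sets borel" and per: "\<And>s. s + 2 * pi \<in> T \<longleftrightarrow> s \<in> T"
    and a: "0 \<le> a" "a \<le> 2 * pi" and \<epsilon>: "\<epsilon> = 1 \<or> \<epsilon> = -1"
  shows "emeasure lborel {s \<in> {0..<2 * pi}. a + \<epsilon> * s \<in> T} = emeasure lborel {s \<in> {0..<2 * pi}. s \<in> T}"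
proof -
  have affine: "emeasure lborel S = emeasure lborel {s. c + \<delta> * s \<in> S}"
    if "S \<in> sets borel" "\<delta> = 1 \<or> \<delta> = -1" for S and c \<delta> :: real
  proof -
    have "emeasure lborel S = emeasure (density (distr lborel borel (\<lambda>x. c + \<delta> * x)) (\<lambda>_. \<bar>\<delta>\<bar>)) S"
      using that(2) by (subst lborel_real_affine[of \<delta> c]) auto
    also have "\<dots> = emeasure (distr lborel borel (\<lambda>x. c + \<delta> * x)) S"
      using that by (auto simp: density_1)
    also have "\<dots> = emeasure lborel {s. c + \<delta> * s \<in> S}"
      using that by (subst emeasure_distr) (auto simp: vimage_def)
    finally show ?thesis .
  qed
  have per': "2 * pi + s \<in> T \<longleftrightarrow> s \<in> T" for s
    using per[of s] by (simp only: add.commute)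
  let ?P = "{a..<a + 2 * pi} \<inter> T"
  have P: "?P \<in> sets borel" using T by simp
  have shift: "emeasure lborel ?P = emeasure lborel ({0..<2 * pi} \<inter> T)"
  proof -
    let ?A = "{a..<2 * pi} \<inter> T" and ?B = "{2 * pi..<a + 2 * pi} \<inter> T" and ?C = "{0..<a} \<inter> T"
    have sets: "?A \<in> sets lborel" "?B \<in> sets lborel" "?C \<in> sets lborel"
      using T by simp_all
    have "{s. 2 * pi + 1 * s \<in> ?B} = ?C"
      using per' by auto
    then have BC: "emeasure lborel ?B = emeasure lborel ?C"
      using affine[of ?B 1 "2 * pi"] sets by simp
    have "?P = ?A \<union> ?B"
      using a by auto
    also have "emeasure lborel (?A \<union> ?B) = emeasure lborel ?A + emeasure lborel ?B"
      by (intro plus_emeasure[symmetric] sets) auto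
    also have "\<dots> = emeasure lborel (?A \<union> ?C)"
      unfolding BC using sets by (intro plus_emeasure) auto
    also have "?A \<union> ?C = {0..<2 * pi} \<inter> T"
      using a by auto
    finally show ?thesis .
  qed
  have conv: "{s \<in> {0..<2 * pi}. s \<in> T} = {0..<2 * pi} \<inter> T" by auto
  show ?thesis
  proof (cases "\<epsilon> = 1")
    case True
    have "{s. a + 1 * s \<in> ?P} = {s \<in> {0..<2 * pi}. a + \<epsilon> * s \<in> T}"
      using True by auto
    then show ?thesis
      using affine[OF P, of 1 a] shift conv by simp
  next
    case False
    with \<epsilon> have \<epsilon>: "\<epsilon> = -1" by simp
    have "{s. (a + 2 * pi) + (-1) * s \<in> ?P} = {s \<in> {0<..2 * pi}. a + \<epsilon> * s \<in> T}"
    proof -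
      have "(a + 2 * pi) + (-1) * s \<in> T \<longleftrightarrow> a + \<epsilon> * s \<in> T" for s
        using per[of "a - s"] \<epsilon> by (simp add: algebra_simps)
      then show ?thesis by auto
    qed
    then have "emeasure lborel {s \<in> {0<..2 * pi}. a + \<epsilon> * s \<in> T} = emeasure lborel ({0..<2 * pi} \<inter> T)"
      using affine[OF P, of "-1" "a + 2 * pi"] shift by simp
    moreover have "emeasure lborel {s \<in> {0<..2 * pi}. a + \<epsilon> * s \<in> T} =
        emeasure lborel {s \<in> {0..<2 * pi}. a + \<epsilon> * s \<in> T}"
    proof (rule emeasure_eq_AE)
      have "AE s in lborel. s \<noteq> 0 \<and> s \<noteq> 2 * pi"
        using AE_lborel_singleton[of 0] AE_lborel_singleton[of "2 * pi"] by eventually_elim auto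
      then show "AE s in lborel. (s \<in> {s \<in> {0<..2 * pi}. a + \<epsilon> * s \<in> T}) =
          (s \<in> {s \<in> {0..<2 * pi}. a + \<epsilon> * s \<in> T})"
        by eventually_elim auto
      have pre: "(\<lambda>s. a + \<epsilon> * s) -` T \<in> sets borel"
        using measurable_sets[OF _ T, of "\<lambda>s. a + \<epsilon> * s" borel] by simp
      have Int: "{s \<in> I. a + \<epsilon> * s \<in> T} = I \<inter> (\<lambda>s. a + \<epsilon> * s) -` T" for I
        by auto
      show "{s \<in> {0<..2 * pi}. a + \<epsilon> * s \<in> T} \<in> sets lborel"
        "{s \<in> {0..<2 * pi}. a + \<epsilon> * s \<in> T} \<in> sets lborel"
        unfolding Int using pre by simp_all
    qed
    ultimately show ?thesis using conv by simp
  qed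
qed

lemma circle_param_frame_change:
  assumes \<theta>: "\<theta> \<in> sphere 0 1" and uv: "orthonormal_frame \<theta> u v" and uv': "orthonormal_frame \<theta> u' v'"
  obtains a \<epsilon> where "0 \<le> a" "a \<le> 2 * pi" "\<epsilon> = 1 \<or> \<epsilon> = -1"
    "\<And>s. circle_param u' v' s = circle_param u v (a + \<epsilon> * s)"
proof -
  have *: "u \<bullet> u = 1" "v \<bullet> v = 1" "u \<bullet> v = 0" "v \<bullet> u = 0"
    using uv by (auto simp: orthonormal_frame_def great_circle_def dot_square_norm inner_commute)
  have frame': "u' \<bullet> u' = 1" "v' \<bullet> v' = 1" "u' \<bullet> v' = 0" "\<theta> \<bullet> u' = 0" "\<theta> \<bullet> v' = 0"
    using uv' by (auto simp: orthonormal_frame_def great_circle_def dot_square_norm inner_commute)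
  define p where "p = u' \<bullet> u"
  define q where "q = u' \<bullet> v"
  define c where "c = v' \<bullet> u"
  define d where "d = v' \<bullet> v"
  have u': "u' = p *\<^sub>R u + q *\<^sub>R v" and v': "v' = c *\<^sub>R u + d *\<^sub>R v"
    using great_circle_expansion[OF \<theta> uv] frame' by (auto simp: p_def q_def c_def d_def)
  have "u' \<bullet> u' = p\<^sup>2 + q\<^sup>2" "v' \<bullet> v' = c\<^sup>2 + d\<^sup>2" "u' \<bullet> v' = p * c + q * d"
    unfolding u' v' using * by (simp_all add: algebra_simps power2_eq_square)
  with frame' have eqs: "p\<^sup>2 + q\<^sup>2 = 1" "c\<^sup>2 + d\<^sup>2 = 1" "p * c + q * d = 0" by auto
  obtain a where a: "0 \<le> a" "a < 2 * pi" "p = cos a" "q = sin a"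
    using sincos_total_2pi[OF eqs(1)] by blast
  define \<epsilon> where "\<epsilon> = p * d - q * c"
  have "\<epsilon>\<^sup>2 = (p\<^sup>2 + q\<^sup>2) * (c\<^sup>2 + d\<^sup>2) - (p * c + q * d)\<^sup>2"
    by (simp add: \<epsilon>_def power2_eq_square algebra_simps)
  then have \<epsilon>: "\<epsilon> = 1 \<or> \<epsilon> = -1"
    by (simp add: eqs power2_eq_1_iff)
  have "\<epsilon> * p = (p\<^sup>2 + q\<^sup>2) * d - q * (p * c + q * d)" "- \<epsilon> * q = (p\<^sup>2 + q\<^sup>2) * c - p * (p * c + q * d)"
    by (simp_all add: \<epsilon>_def power2_eq_square algebra_simps)
  then have cd: "d = \<epsilon> * cos a" "c = - \<epsilon> * sin a"
    unfolding eqs using a by auto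
  have "circle_param u' v' s = circle_param u v (a + \<epsilon> * s)" for s
    using \<epsilon> unfolding circle_param_def u' v' cd a(3,4)
    by (auto simp: cos_add sin_add cos_diff sin_diff algebra_simps)
  then show thesis using that[of a \<epsilon>] a \<epsilon> by auto
qed

lemma great_circle_measure_eq:
  assumes \<theta>: "\<theta> \<in> sphere 0 1" and uv': "orthonormal_frame \<theta> u' v'"
  shows "great_circle_measure \<theta> =
           distr (restrict_space lborel {0..<2 * pi}) (restrict_space borel (great_circle \<theta>))
             (circle_param u' v')"
proof -
  let ?N = "restrict_space borel (great_circle \<theta>)"
  let ?D = "\<lambda>u v. distr (restrict_space lborel {0..<2 * pi}) ?N (circle_param u v)"
  obtain u v where some: "(SOME (u, v). orthonormal_frame \<theta> u v) = (u, v)"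
    by (cases "SOME (u, v). orthonormal_frame \<theta> u v")
  have "case (SOME (u, v). orthonormal_frame \<theta> u v) of (u, v) \<Rightarrow> orthonormal_frame \<theta> u v"
    by (rule someI_ex) (use uv' in auto)
  with some have uv: "orthonormal_frame \<theta> u v" by simp
  obtain a \<epsilon> where a: "0 \<le> a" "a \<le> 2 * pi" and \<epsilon>: "\<epsilon> = 1 \<or> \<epsilon> = -1"
    and change: "\<And>s. circle_param u' v' s = circle_param u v (a + \<epsilon> * s)"
    using circle_param_frame_change[OF \<theta> uv uv'] by blast
  have D: "emeasure (?D x y) A = emeasure lborel {s \<in> {0..<2 * pi}. circle_param x y s \<in> A}"
    if "orthonormal_frame \<theta> x y" "A \<in> sets ?N" for x y A
  proof -
    have "circle_param x y \<in> measurable (restrict_space lborel {0..<2 * pi}) ?N"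
      by (intro measurable_restrict_space1) (use measurable_circle_param[OF that(1)] in simp)
    then show ?thesis
      using that by (subst emeasure_distr)
        (auto simp: emeasure_restrict_space space_restrict_space intro!: arg_cong[where f = "emeasure lborel"])
  qed
  have "?D u v = ?D u' v'"
  proof (rule measure_eqI)
    fix A assume "A \<in> sets (?D u v)"
    then have A: "A \<in> sets ?N" by simp
    have T: "circle_param u v -` A \<in> sets borel"
      using measurable_sets[OF measurable_circle_param[OF uv] A] by simp
    show "emeasure (?D u v) A = emeasure (?D u' v') A"
      using emeasure_lborel_periodic[OF T _ a \<epsilon>]
      by (simp add: D[OF uv A] D[OF uv' A] change) (simp add: circle_param_def)
  qed simp
  then show ?thesis
    by (simp add: great_circle_measure_def some)
qed


section \<open>The transforms\<close>

definition locally_integrable :: "(real^3 \<Rightarrow> real) \<Rightarrow> bool" where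
  "locally_integrable f \<longleftrightarrow> (\<forall>K. compact K \<longrightarrow> set_integrable lborel K f)"

definition sphere_locally_integrable :: "(real^3 \<Rightarrow> real \<Rightarrow> real) \<Rightarrow> bool" where
  "sphere_locally_integrable \<phi> \<longleftrightarrow>
     (\<forall>K. compact K \<and> K \<subseteq> sphere 0 1 \<times> {0..} \<longrightarrow>
        set_integrable (sphere_measure \<Otimes>\<^sub>M lborel) K (\<lambda>(\<alpha>, t). \<phi> \<alpha> t))"

definition sphere_even :: "(real^3 \<Rightarrow> real \<Rightarrow> real) \<Rightarrow> bool" where
  "sphere_even \<phi> \<longleftrightarrow> (\<forall>\<alpha>\<in>sphere 0 1. \<forall>t\<ge>0. \<phi> \<alpha> t = \<phi> (- \<alpha>) t)"

definition radon_type_transform :: "real \<Rightarrow> (real^3 \<Rightarrow> real) \<Rightarrow> real^3 \<Rightarrow> real \<Rightarrow> real" where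
  "radon_type_transform r f \<theta> t =
     (\<integral>\<alpha>. (\<integral>\<beta>. f (r *\<^sub>R \<alpha> + t *\<^sub>R \<beta>) \<partial>sphere_measure) \<partial>great_circle_measure \<theta>)"

text \<open>
  The spherical Radon transform and the Minkowski--Funk transform are partial operators.
  Outside their domains they are left unspecified, so an equation about their value is
  provable only where they are defined.
\<close>

definition spherical_radon_transform :: "real \<Rightarrow> (real^3 \<Rightarrow> real) \<Rightarrow> real^3 \<Rightarrow> real \<Rightarrow> real" where
  "spherical_radon_transform r f \<alpha> t =
     (if locally_integrable f
      then \<integral>\<beta>. f (r *\<^sub>R \<alpha> + t *\<^sub>R \<beta>) \<partial>sphere_measure
      else undefined)"

definition minkowski_funk_transform :: "(real^3 \<Rightarrow> real \<Rightarrow> real) \<Rightarrow> real^3 \<Rightarrow> real \<Rightarrow> real" where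
  "minkowski_funk_transform \<phi> \<theta> t =
     (if sphere_locally_integrable \<phi> \<and> sphere_even \<phi>
      then \<integral>\<alpha>. \<phi> \<alpha> t \<partial>great_circle_measure \<theta>
      else undefined)"

end

theory Submission
  imports Defs
begin

text \<open>
  The identity is Fubini-free: the inner integral is the spherical Radon transform. The content
  is that this transform lies in the domain of the Minkowski--Funk transform. It is bounded because
  \<open>f\<close> is and the sphere has finite measure, and even because the surface measure is invariant under
  \<open>\<beta> \<mapsto> - \<beta>\<close>, so that the symmetry of \<open>f\<close> can be applied to
  \<open>- r\<alpha> - t\<beta> = - (r\<alpha> + t\<beta>)\<close>.
\<close>

text \<open>The cone over the whole sphere lies in the unit ball, which has finite Lebesgue
  measure.\<close>

lemma finite_measure_sphere_measure: "finite_measure (sphere_measure :: 'a::euclidean_space measure)"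
proof
  let ?C = "{r *\<^sub>R a | r a. 0 < r \<and> r \<le> 1 \<and> a \<in> sphere (0::'a) 1}"
  have "emeasure lborel ?C \<le> emeasure lborel (cball (0::'a) 1)"
    by (rule emeasure_mono) auto
  also have "\<dots> < \<infinity>"
    by (intro emeasure_bounded_finite bounded_cball)
  finally show "emeasure sphere_measure (space (sphere_measure :: 'a measure)) \<noteq> \<infinity>"
    by (simp add: emeasure_sphere_measure ennreal_mult_eq_top_iff)
qed

text \<open>Reflection is linear with determinant of absolute value 1. Measurability is not assumed,
  so the lemma applies to cones without showing that they are Borel: negation is an involution, so
  \<open>A\<close> and its reflection can only fail to be Borel together, and then
  \<open>emeasure\<close> is 0 on both.\<close>

lemma emeasure_lborel_uminus_vimage:
  fixes A :: "'a::euclidean_space set"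
  shows "emeasure lborel (uminus -` A) = emeasure lborel A"
proof (cases "A \<in> sets borel")
  case True
  have "lborel = distr lborel borel (uminus :: 'a \<Rightarrow> 'a)"
    using lborel_affine[of "-1::real" "0::'a"] by (simp add: density_1)
  then have "emeasure lborel A = emeasure (distr lborel borel uminus) A"
    by simp
  also have "\<dots> = emeasure lborel (uminus -` A)"
    using True by (subst emeasure_distr) auto
  finally show ?thesis ..
next
  case False
  have "uminus -` A \<notin> sets borel"
  proof
    assume "uminus -` A \<in> sets borel"
    then have "uminus -` (uminus -` A) \<in> sets borel"
      using measurable_sets[of uminus borel borel "uminus -` A"] by simp
    then show False
      using False by (simp add: vimage_def)
  qed
  then show ?thesis
    using False by (simp add: emeasure_notin_sets)
qed

lemma measurable_uminus_sphere_measure: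
  "uminus \<in> measurable sphere_measure (sphere_measure :: 'a::euclidean_space measure)"
proof -
  have "(uminus :: 'a \<Rightarrow> 'a) \<in> measurable (restrict_space borel (sphere 0 1)) (restrict_space borel (sphere 0 1))"
    by (rule measurable_restrict_space3) auto
  then show ?thesis
    by (simp cong: measurable_cong_sets)
qed

text \<open>Taking cones commutes with negation, so the invariance is inherited from Lebesgue
  measure.\<close>

lemma distr_sphere_measure_uminus:
  "distr sphere_measure sphere_measure uminus = (sphere_measure :: 'a::euclidean_space measure)"
proof (rule measure_eqI)
  fix A :: "'a set"
  assume "A \<in> sets (distr sphere_measure sphere_measure uminus)"
  then have A: "A \<in> sets borel" "A \<subseteq> sphere 0 1" and A': "A \<in> sets sphere_measure"
    by (auto simp: sets_restrict_space)
  have B: "uminus -` A \<in> sets borel" "uminus -` A \<subseteq> sphere 0 1"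
    using measurable_sets[of uminus borel borel A] A by auto
  define cone where "cone A = {r *\<^sub>R a | r a. 0 < r \<and> r \<le> 1 \<and> a \<in> A}" for A :: "'a set"
  have "cone (uminus -` A) = uminus -` cone A"
  proof (intro set_eqI iffI)
    fix x assume "x \<in> cone (uminus -` A)"
    then obtain s a where "x = s *\<^sub>R a" "0 < s" "s \<le> 1" "- a \<in> A"
      by (auto simp: cone_def)
    then show "x \<in> uminus -` cone A"
      by (auto simp: cone_def intro!: exI[of _ s] exI[of _ "- a"])
  next
    fix x assume "x \<in> uminus -` cone A"
    then obtain s a where sa: "- x = s *\<^sub>R a" "0 < s" "s \<le> 1" "a \<in> A"
      by (auto simp: cone_def)
    then have "x = s *\<^sub>R (- a)"
      by (simp add: minus_equation_iff[of x])
    then show "x \<in> cone (uminus -` A)"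
      using sa by (auto simp: cone_def intro!: exI[of _ s] exI[of _ "- a"])
  qed
  \<comment> \<open>\<open>emeasure_distr\<close> yields the preimage intersected with the space,
    here the sphere.\<close>
  moreover have "uminus -` A \<inter> sphere 0 1 = uminus -` A"
    using B by auto
  ultimately show "emeasure (distr sphere_measure sphere_measure uminus) A = emeasure sphere_measure A"
    using A A' B emeasure_lborel_uminus_vimage[of "cone A"]
    by (simp add: emeasure_distr measurable_uminus_sphere_measure emeasure_sphere_measure cone_def)
qed simp

lemma borel_measurable_sphere_measure:
  "f \<in> borel_measurable borel \<Longrightarrow> f \<in> borel_measurable sphere_measure"
  by (simp add: measurable_restrict_space1 cong: measurable_cong_sets)

lemma integral_sphere_measure_uminus:
  fixes g :: "'a::euclidean_space \<Rightarrow> real"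
  assumes "g \<in> borel_measurable borel"
  shows "(\<integral>\<beta>. g (- \<beta>) \<partial>sphere_measure) = (\<integral>\<beta>. g \<beta> \<partial>sphere_measure)"
  using integral_distr[OF measurable_uminus_sphere_measure borel_measurable_sphere_measure[OF assms]]
  by (simp add: distr_sphere_measure_uminus)

text \<open>This discharges the guard of \<open>spherical_radon_transform\<close>, whose value is
  then the integral and not \<open>undefined\<close>.\<close>

lemma continuous_imp_locally_integrable:
  assumes "continuous_on UNIV f"
  shows "locally_integrable f"
  unfolding locally_integrable_def set_integrable_def
  using borel_integrable_compact continuous_on_subset[OF assms] by fastforce

lemma sphere_even_spherical_radon_transform:
  assumes f: "continuous_on UNIV f" and even: "\<And>x. f (- x) = f x"
  shows "sphere_even (spherical_radon_transform r f)"
proof -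
  have "(\<integral>\<beta>. f (r *\<^sub>R \<alpha> + t *\<^sub>R \<beta>) \<partial>sphere_measure) =
        (\<integral>\<beta>. f (r *\<^sub>R (- \<alpha>) + t *\<^sub>R \<beta>) \<partial>sphere_measure)" for \<alpha> t
  proof -
    have "continuous_on UNIV (\<lambda>\<beta>. f (r *\<^sub>R (- \<alpha>) + t *\<^sub>R \<beta>))"
      by (intro continuous_on_compose2[OF f] continuous_intros) auto
    then have "(\<integral>\<beta>. f (r *\<^sub>R (- \<alpha>) + t *\<^sub>R \<beta>) \<partial>sphere_measure) =
        (\<integral>\<beta>. f (r *\<^sub>R (- \<alpha>) + t *\<^sub>R (- \<beta>)) \<partial>sphere_measure)"
      by (intro integral_sphere_measure_uminus[symmetric] borel_measurable_continuous_onI)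
    also have "(\<lambda>\<beta>. f (r *\<^sub>R (- \<alpha>) + t *\<^sub>R (- \<beta>))) = (\<lambda>\<beta>. f (r *\<^sub>R \<alpha> + t *\<^sub>R \<beta>))"
    proof
      show "f (r *\<^sub>R (- \<alpha>) + t *\<^sub>R (- \<beta>)) = f (r *\<^sub>R \<alpha> + t *\<^sub>R \<beta>)" for \<beta>
        using even[of "r *\<^sub>R \<alpha> + t *\<^sub>R \<beta>"] by simp
    qed
    finally show ?thesis ..
  qed
  \<comment> \<open>The guard depends on \<open>f\<close> alone, so it selects the same branch at
    \<alpha> and at -\<alpha>.\<close>
  then show ?thesis
    by (simp add: sphere_even_def spherical_radon_transform_def)
qed

text \<open>A bounded measurable function is integrable over a set of finite measure.\<close>

lemma sphere_locally_integrable_spherical_radon_transform: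
  assumes f: "continuous_on UNIV f" and bound: "\<And>x. \<bar>f x\<bar> \<le> B"
  shows "sphere_locally_integrable (spherical_radon_transform r f)"
  unfolding sphere_locally_integrable_def
proof safe
  interpret finite_measure "sphere_measure :: (real^3) measure"
    by (rule finite_measure_sphere_measure)
  let ?P = "(sphere_measure :: (real^3) measure) \<Otimes>\<^sub>M (lborel :: real measure)"
  let ?g = "\<lambda>(\<alpha>, t). spherical_radon_transform r f \<alpha> t"
  fix K :: "((real^3) \<times> real) set"
  assume K: "compact K" "K \<subseteq> sphere 0 1 \<times> {0..}"
  have id [measurable]: "(\<lambda>x. x) \<in> borel_measurable (sphere_measure :: (real^3) measure)"
    by (rule borel_measurable_sphere_measure) simp
  have [measurable]: "f \<in> borel_measurable borel"
    using f by (rule borel_measurable_continuous_onI)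
  \<comment> \<open>\<open>K\<close> is Borel in the full product space, while \<open>?P\<close>
    carries the trace on the sphere in its first factor. Pulling \<open>K\<close> back along the
    inclusion, written as a pair of measurable coordinates, transfers measurability; the preimage is
    \<open>K\<close> itself.\<close>
  have "(\<lambda>x. (fst x, snd x)) \<in> borel_measurable ?P"
    by measurable
  then have "(\<lambda>x. (fst x, snd x)) -` K \<inter> space ?P \<in> sets ?P"
    by (rule measurable_sets) (use K in \<open>simp add: compact_imp_closed\<close>)
  moreover have "(\<lambda>x. (fst x, snd x)) -` K \<inter> space ?P = K"
    using K by (auto simp: space_pair_measure)
  ultimately have "K \<in> sets ?P"
    by simp
  moreover have "emeasure ?P K < \<infinity>"
  proof -
    have cpt: "compact (snd ` K)"
      by (intro compact_continuous_image continuous_intros K)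
    have T: "snd ` K \<in> sets lborel"
      using cpt by (simp add: compact_imp_closed)
    have S: "sphere 0 1 \<in> sets (sphere_measure :: (real^3) measure)"
      using sets.top[of "sphere_measure :: (real^3) measure"] by simp
    \<comment> \<open>The enclosing product has finite measure: its factors are the whole sphere and
      the compact projection of \<open>K\<close> to the t-axis.\<close>
    have "emeasure ?P K \<le> emeasure ?P (sphere 0 1 \<times> snd ` K)"
      by (rule emeasure_mono) (use K S T in force)+
    also have "\<dots> = emeasure sphere_measure (sphere 0 1 :: (real^3) set) * emeasure lborel (snd ` K)"
      by (rule lborel.emeasure_pair_measure_Times[OF S T])
    also have "\<dots> < \<infinity>"
      using emeasure_compact_finite[OF cpt]
      by (simp add: ennreal_mult_eq_top_iff less_top[symmetric])
    finally show ?thesis .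
  qed
  \<comment> \<open>The integrand is jointly measurable in \<alpha>, t and \<beta>; integrating out
    \<beta> preserves measurability since the sphere measure is sigma-finite.\<close>
  moreover have "?g \<in> borel_measurable ?P"
    using continuous_imp_locally_integrable[OF f]
    by (simp add: spherical_radon_transform_def)
  moreover have "\<bar>?g x\<bar> \<le> B * measure sphere_measure (sphere 0 1 :: (real^3) set)" for x
  proof (cases x)
    case (Pair \<alpha> t)
    have "integrable sphere_measure (\<lambda>\<beta>. f (r *\<^sub>R \<alpha> + t *\<^sub>R \<beta>))"
      by (rule integrable_const_bound[of _ B]) (use bound in auto)
    then have "\<bar>\<integral>\<beta>. f (r *\<^sub>R \<alpha> + t *\<^sub>R \<beta>) \<partial>sphere_measure\<bar> \<le>
        (\<integral>\<beta>. B \<partial>(sphere_measure :: (real^3) measure))"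
      using bound by (intro order_trans[OF integral_abs_bound] integral_mono) auto
    then show ?thesis
      using continuous_imp_locally_integrable[OF f]
      by (simp add: Pair spherical_radon_transform_def mult.commute)
  qed
  ultimately show "set_integrable ?P K ?g"
    unfolding set_integrable_def
    by (intro integrableI_bounded_set_indicator[where B = "B * measure sphere_measure (sphere 0 1 :: (real^3) set)"])
      auto
qed

lemma compactly_supported_continuous_bounded:
  fixes f :: "'a::euclidean_space \<Rightarrow> real"
  assumes "continuous_on UNIV f" "compactly_supported_in f U"
  obtains B where "\<And>x. \<bar>f x\<bar> \<le> B"
proof -
  have "compact (f ` closure {x. f x \<noteq> 0})"
    using assms by (intro compact_continuous_image continuous_on_subset[OF assms(1)])
      (auto simp: compactly_supported_in_def)
  then obtain B where "B > 0" and B: "\<And>y. y \<in> f ` closure {x. f x \<noteq> 0} \<Longrightarrow> \<bar>y\<bar> \<le> B"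
    using compact_imp_bounded bounded_pos by (metis real_norm_def)
  \<comment> \<open>Off the support \<open>f\<close> is 0, where positivity of \<open>B\<close>
    gives the bound, even for empty support.\<close>
  have "\<bar>f x\<bar> \<le> B" for x
    using B[of "f x"] \<open>B > 0\<close> closure_subset[of "{x. f x \<noteq> 0}"] by (cases "f x = 0") auto
  then show thesis
    by (rule that)
qed

theorem theorem3:
  fixes r_det :: real and f :: "real^3 \<Rightarrow> real"
  assumes "r_det > 0"
    and "smooth f"
    and "compactly_supported_in f (ball 0 r_det)"
    and "\<forall>x. f x = f (- x)"
  shows "\<forall>\<theta>\<in>sphere 0 1. \<forall>t\<ge>0.
           radon_type_transform r_det f \<theta> t =
           minkowski_funk_transform (spherical_radon_transform r_det f) \<theta> t"
proof -
  \<comment> \<open>Continuity is the case \<open>k = 0\<close> of smoothness.\<close>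
  have cont: "continuous_on UNIV f"
    using \<open>smooth f\<close> k_times_differentiable.simps(1) unfolding smooth_def by blast
  obtain B where "\<And>x. \<bar>f x\<bar> \<le> B"
    using compactly_supported_continuous_bounded[OF cont assms(3)] by blast
  then have "sphere_locally_integrable (spherical_radon_transform r_det f)"
    by (rule sphere_locally_integrable_spherical_radon_transform[OF cont])
  moreover have "sphere_even (spherical_radon_transform r_det f)"
    using assms(4) by (intro sphere_even_spherical_radon_transform[OF cont]) simp
  \<comment> \<open>Both guards now hold, so the two sides unfold to the same iterated
    integral.\<close>
  ultimately show ?thesis
    using continuous_imp_locally_integrable[OF cont]
    by (simp add: radon_type_transform_def minkowski_funk_transform_def spherical_radon_transform_def)
qed

end
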